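(* Let $\mathcal{N}$ be a quantum network that makes $T$ queries to a black-box $X\in\{0,1\}^N$, and let $B$ be a set of computational basis states. Then there exists a real-valued multilinear $N$-variate polynomial $P(X)$ of degree at most $2T$ which, for every $X\in\{0,1\}^N$, equals the probability that observing the final state of the network with black-box $X$ yields a state from $B$.
   Context: Quantum networks: the input $X=(x_0,\ldots,x_{N-1})\in\{0,1\}^N$ is given as a black-box. A quantum network with $T$ queries acts on $m$ qubits (for some $m$), with $2^m$ computational basis states, and is a sequence of unitary transformations $U_0,O,U_1,O,\ldots,U_{T-1},O,U_T$ applied in this order to the initial state $|0\rangle$, where the $U_j$ are arbitrary unitaries on $m$ qubits not depending on $X$, and the query $O$ (depending on $X$) maps each basis state $|i,b,z\rangle$ to $|i,b\oplus x_i,z\rangle$; here $i$ consists of $\lceil\log_2 N\rceil$ bits, $b$ is one bit, and $z$ consists of the remaining $m-\lceil\log_2 N\rceil-1$ bits (if $i\ge N$, the query leaves the basis state unchanged). If the final state is $\sum_k\alpha_k|k\rangle$ (sum over the basis states), then observing it yields $|k\rangle$ with probability $|\alpha_k|^2$. *)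

theory Defs
  imports
    "HOL-Library.Log_Nat"
    "HOL-Library.Poly_Mapping"
    "Jordan_Normal_Form.Schur_Decomposition"
begin

text \<open>A real polynomial in variables indexed by naturals: a finitely supported map from monomials
  (finitely supported exponent functions) to coefficients.\<close>

type_synonym real_mpoly = "(nat \<Rightarrow>\<^sub>0 nat) \<Rightarrow>\<^sub>0 real"

definition mpoly_eval :: "real_mpoly \<Rightarrow> (nat \<Rightarrow> real) \<Rightarrow> real" where
  "mpoly_eval P x = (\<Sum>\<mu>\<in>Poly_Mapping.keys P.
     Poly_Mapping.lookup P \<mu> * (\<Prod>i\<in>Poly_Mapping.keys \<mu>. x i ^ Poly_Mapping.lookup \<mu> i))"

definition mpoly_vars :: "real_mpoly \<Rightarrow> nat set" where
  "mpoly_vars P = (\<Union>\<mu>\<in>Poly_Mapping.keys P. Poly_Mapping.keys \<mu>)"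

definition monomial_degree :: "(nat \<Rightarrow>\<^sub>0 nat) \<Rightarrow> nat" where
  "monomial_degree \<mu> = (\<Sum>i\<in>Poly_Mapping.keys \<mu>. Poly_Mapping.lookup \<mu> i)"

text \<open>The zero polynomial is given degree 0.\<close>

definition mpoly_degree :: "real_mpoly \<Rightarrow> nat" where
  "mpoly_degree P = Max (insert 0 (monomial_degree ` Poly_Mapping.keys P))"

definition multilinear :: "real_mpoly \<Rightarrow> bool" where
  "multilinear P \<longleftrightarrow> (\<forall>\<mu>\<in>Poly_Mapping.keys P. \<forall>i. Poly_Mapping.lookup \<mu> i \<le> 1)"

text \<open>The computational basis states of \<open>m\<close> qubits are numbered \<open>0, \<dots>, 2 ^ m - 1\<close> by
  reading their bits as a binary number, most significant bit first. For input length \<open>N\<close>, the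
  state \<open>|i, b, z\<rangle>\<close> has \<open>ceillog2 N\<close> bits for \<open>i\<close>, one for \<open>b\<close>, and \<open>workspace_bits N m\<close> for
  \<open>z\<close>. The subtraction does not truncate for a \<open>quantum_network\<close>, defined below.\<close>

definition workspace_bits :: "nat \<Rightarrow> nat \<Rightarrow> nat" where
  "workspace_bits N m = m - ceillog2 N - 1"

definition ket_index :: "nat \<Rightarrow> nat \<Rightarrow> nat \<Rightarrow> bool \<Rightarrow> nat \<Rightarrow> nat" where
  "ket_index N m i b z =
     i * 2 ^ (workspace_bits N m + 1) + of_bool b * 2 ^ workspace_bits N m + z"

text \<open>A black-box \<open>X\<close> of length \<open>N\<close> is a list of \<open>N\<close> bits.\<close>

definition query_basis :: "nat \<Rightarrow> bool list \<Rightarrow> nat \<Rightarrow> nat" where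
  "query_basis m X k =
     (let N = length X;
          w = workspace_bits N m;
          i = k div 2 ^ (w + 1);
          b = odd (k div 2 ^ w);
          z = k mod 2 ^ w
      in if i < N then ket_index N m i (b \<noteq> X ! i) z else k)"

lemma query_basis_ket_index:
  assumes "z < 2 ^ workspace_bits (length X) m"
  shows "query_basis m X (ket_index (length X) m i b z) =
    ket_index (length X) m i (if i < length X then b \<noteq> X ! i else b) z"
proof -
  define N where "N = length X"
  define w where "w = workspace_bits N m"
  have k: "ket_index N m i b z = z + (2 * i + of_bool b) * 2 ^ w"
    by (simp add: ket_index_def w_def algebra_simps)
  have z: "z < 2 ^ w"
    using assms by (simp add: w_def N_def)
  have 1: "ket_index N m i b z div 2 ^ w = 2 * i + of_bool b"
    using z unfolding k by (subst div_mult_self1) auto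
  have 2: "ket_index N m i b z mod 2 ^ w = z"
    using z unfolding k by simp
  have "ket_index N m i b z div 2 ^ (w + 1) = ket_index N m i b z div 2 ^ w div 2"
    by (metis add.commute div_exp_eq power_one_right)
  also have "\<dots> = i"
    by (simp add: 1)
  finally have 3: "ket_index N m i b z div 2 ^ (w + 1) = i" .
  show ?thesis
    using 1 2 3 by (simp add: query_basis_def Let_def flip: N_def w_def)
qed

text \<open>The linear extension of the action on basis states.\<close>

definition query_mat :: "nat \<Rightarrow> bool list \<Rightarrow> complex mat" where
  "query_mat m X = mat (2 ^ m) (2 ^ m) (\<lambda>(r, c). if r = query_basis m X c then 1 else 0)"

definition unitary_mat :: "nat \<Rightarrow> complex mat \<Rightarrow> bool" where
  "unitary_mat n U \<longleftrightarrow> U \<in> carrier_mat n n \<and>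
     mat_adjoint U * U = 1\<^sub>m n \<and> U * mat_adjoint U = 1\<^sub>m n"

text \<open>A network with \<open>T\<close> queries on \<open>m\<close> qubits for inputs of length \<open>N\<close> is given by the unitaries
  \<open>U 0, \<dots>, U T\<close>; the values \<open>U j\<close> with \<open>j > T\<close> play no role.\<close>

definition quantum_network :: "nat \<Rightarrow> nat \<Rightarrow> nat \<Rightarrow> (nat \<Rightarrow> complex mat) \<Rightarrow> bool" where
  "quantum_network N m T U \<longleftrightarrow>
     ceillog2 N + 1 \<le> m \<and> (\<forall>j\<le>T. unitary_mat (2 ^ m) (U j))"

primrec network_state :: "nat \<Rightarrow> (nat \<Rightarrow> complex mat) \<Rightarrow> bool list \<Rightarrow> nat \<Rightarrow> complex vec" where
  "network_state m U X 0 = U 0 *\<^sub>v unit_vec (2 ^ m) 0"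
| "network_state m U X (Suc t) = U (Suc t) *\<^sub>v (query_mat m X *\<^sub>v network_state m U X t)"

definition observation_prob :: "complex vec \<Rightarrow> nat set \<Rightarrow> real" where
  "observation_prob \<psi> B = (\<Sum>k\<in>B. (cmod (\<psi> $ k))\<^sup>2)"

end

theory Submission
  imports Defs
begin

text \<open>Each entry of the query matrix is affine in the bits of the black-box, so by induction every
  amplitude after \<open>t\<close> queries is a multilinear polynomial of degree at most \<open>t\<close> in the input
  bits: \<open>x\<^sub>i * x\<^sub>i = x\<^sub>i\<close> keeps products of multilinear polynomials multilinear. The
  probability of a basis state is the amplitude times its complex conjugate, of degree at most
  \<open>2 T\<close>.\<close>

text \<open>The monomial of \<open>S\<close> is the conjunction of its bits, so the idempotence of
  bits is built in and no exponents occur. Rule \<open>cong\<close> compares functions only on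
  inputs of length \<open>N\<close>, because \<open>query_basis\<close> reads the input length off
  its argument.\<close>

inductive multilinear_fun :: "nat \<Rightarrow> nat \<Rightarrow> (bool list \<Rightarrow> complex) \<Rightarrow> bool" for N d where
  monomial: "S \<subseteq> {..<N} \<Longrightarrow> card S \<le> d \<Longrightarrow> multilinear_fun N d (\<lambda>X. a * of_bool (\<forall>i\<in>S. X ! i))"
| cong: "multilinear_fun N d f \<Longrightarrow> (\<And>X. length X = N \<Longrightarrow> g X = f X) \<Longrightarrow> multilinear_fun N d g"
| add: "multilinear_fun N d f \<Longrightarrow> multilinear_fun N d g \<Longrightarrow> multilinear_fun N d (\<lambda>X. f X + g X)"

lemma multilinear_fun_const: "multilinear_fun N d (\<lambda>X. a)"
  using multilinear_fun.monomial[of "{}" N d a] by simp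

lemma multilinear_fun_sum:
  assumes "\<And>k. k \<in> A \<Longrightarrow> multilinear_fun N d (f k)"
  shows "multilinear_fun N d (\<lambda>X. \<Sum>k\<in>A. f k X)"
  using assms
  by (induction A rule: infinite_finite_induct)
     (auto intro: multilinear_fun_const multilinear_fun.add)

text \<open>Two monomials over \<open>S\<close> and \<open>S'\<close> multiply to the monomial over
  \<open>S \<union> S'\<close>, whose size is at most \<open>card S + card S'\<close>.
  Distributivity carries this over to sums.\<close>

lemma multilinear_fun_mult:
  assumes "multilinear_fun N d f" and "multilinear_fun N e g"
  shows "multilinear_fun N (d + e) (\<lambda>X. f X * g X)"
  using assms(1)
proof induction
  case (monomial S a)
  show ?case
    using assms(2)
  proof induction
    case (monomial S' b)
    have "multilinear_fun N (d + e) (\<lambda>X. (a * b) * of_bool (\<forall>i\<in>S \<union> S'. X ! i))"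
      using \<open>S \<subseteq> {..<N}\<close> \<open>card S \<le> d\<close> monomial card_Un_le[of S S']
      by (intro multilinear_fun.monomial) auto
    then show ?case
      by (rule multilinear_fun.cong) (simp add: ball_Un)
  next
    case (cong g h)
    from cong.IH show ?case
      by (rule multilinear_fun.cong) (simp add: cong.hyps)
  next
    case (add g h)
    from multilinear_fun.add[OF add.IH] show ?case
      by (simp add: distrib_left)
  qed
next
  case (cong f h)
  from cong.IH show ?case
    by (rule multilinear_fun.cong) (simp add: cong.hyps)
next
  case (add f h)
  from multilinear_fun.add[OF add.IH] show ?case
    by (simp add: distrib_right)
qed

text \<open>Bits are real, so conjugation only changes the coefficients.\<close>

lemma multilinear_fun_cnj:
  assumes "multilinear_fun N d f"
  shows "multilinear_fun N d (\<lambda>X. cnj (f X))"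
  using assms
proof induction
  case (monomial S a)
  have "cnj (of_bool p) = of_bool p" for p
    by (cases p) auto
  with multilinear_fun.monomial[OF monomial, of "cnj a"] show ?case
    by simp
next
  case (cong f g)
  from cong.IH show ?case
    by (rule multilinear_fun.cong) (simp add: cong.hyps)
next
  case (add f g)
  from multilinear_fun.add[OF add.IH] show ?case
    by simp
qed

text \<open>Collecting equal monomials gives a normal form. The point is that one family
  \<open>c\<close> serves all inputs, so it can supply the coefficients of a polynomial.\<close>

lemma multilinear_fun_coefficients:
  assumes "multilinear_fun N d f"
  shows "\<exists>c. \<forall>X. length X = N \<longrightarrow>
    f X = (\<Sum>S | S \<subseteq> {..<N} \<and> card S \<le> d. c S * of_bool (\<forall>i\<in>S. X ! i))"
  using assms
proof induction
  case (monomial S a)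
  have fin: "finite {S. S \<subseteq> {..<N} \<and> card S \<le> d}"
    by (rule finite_subset[of _ "Pow {..<N}"]) auto
  have "(\<Sum>S' | S' \<subseteq> {..<N} \<and> card S' \<le> d.
      (if S' = S then a else 0) * of_bool (\<forall>i\<in>S'. X ! i)) = a * of_bool (\<forall>i\<in>S. X ! i)" for X
    using monomial fin by (simp add: if_distrib[of "\<lambda>y. y * _"] cong: if_cong)
  then show ?case
    by (intro exI[of _ "\<lambda>S'. if S' = S then a else 0"]) simp
next
  case (cong f g)
  then show ?case by auto
next
  case (add f g)
  then obtain c c' where
    "\<forall>X. length X = N \<longrightarrow> f X = (\<Sum>S | S \<subseteq> {..<N} \<and> card S \<le> d. c S * of_bool (\<forall>i\<in>S. X ! i))"
    "\<forall>X. length X = N \<longrightarrow> g X = (\<Sum>S | S \<subseteq> {..<N} \<and> card S \<le> d. c' S * of_bool (\<forall>i\<in>S. X ! i))"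
    by blast
  then show ?case
    by (intro exI[of _ "\<lambda>S. c S + c' S"]) (simp add: distrib_right sum.distrib)
qed

text \<open>The image of the basis state \<open>k\<close> depends on at most one bit of the input,
  the one addressed by \<open>k\<close>, and a function of a single bit is affine in it.\<close>

lemma multilinear_fun_query_mat_entry:
  "multilinear_fun N 1 (\<lambda>X. of_bool (r = query_basis m X k))"
proof -
  define w where "w = workspace_bits N m"
  define i where "i = k div 2 ^ (w + 1)"
  define b where "b = odd (k div 2 ^ w)"
  define K where "K b' = ket_index N m i b' (k mod 2 ^ w)" for b'
  show ?thesis
  proof (cases "i < N")
    case True
    \<comment> \<open>Interpolation between the two values of bit \<open>i\<close>: the image of
      \<open>k\<close> is \<open>K b\<close> if the bit is 0 and \<open>K (\<not> b)\<close> if it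
      is 1.\<close>
    have "multilinear_fun N 1 (\<lambda>X. of_bool (r = K b) +
        (of_bool (r = K (\<not> b)) - of_bool (r = K b)) * of_bool (\<forall>j\<in>{i}. X ! j))"
      using True
      by (intro multilinear_fun.add multilinear_fun_const multilinear_fun.monomial) auto
    then show ?thesis
      by (rule multilinear_fun.cong)
         (use True in \<open>auto simp: query_basis_def Let_def K_def w_def i_def b_def\<close>)
  next
    case False
    \<comment> \<open>An address outside the input leaves \<open>k\<close> fixed, so the entry is
      constant.\<close>
    from multilinear_fun_const show ?thesis
      by (rule multilinear_fun.cong[of _ _ "\<lambda>X. of_bool (r = k)"])
         (use False in \<open>auto simp: query_basis_def Let_def w_def i_def\<close>)
  qed
qed

text \<open>Each coordinate is a sum of products of entries, so degrees add. The matrix may depend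
  on the input, which covers queries (\<open>d = 1\<close>) as well as fixed unitaries
  (\<open>d = 0\<close>).\<close>

lemma multilinear_fun_mult_mat_vec:
  assumes "\<And>X. length X = N \<Longrightarrow> A X \<in> carrier_mat n n"
    and "\<And>X. length X = N \<Longrightarrow> v X \<in> carrier_vec n"
    and "\<And>r c. r < n \<Longrightarrow> c < n \<Longrightarrow> multilinear_fun N d (\<lambda>X. A X $$ (r, c))"
    and "\<And>c. c < n \<Longrightarrow> multilinear_fun N e (\<lambda>X. v X $ c)"
    and "r < n"
  shows "multilinear_fun N (d + e) (\<lambda>X. (A X *\<^sub>v v X) $ r)"
proof -
  have "multilinear_fun N (d + e) (\<lambda>X. \<Sum>c<n. A X $$ (r, c) * v X $ c)"
    using assms by (intro multilinear_fun_sum multilinear_fun_mult) auto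
  then show ?thesis
  proof (rule multilinear_fun.cong)
    fix X :: "bool list"
    assume X: "length X = N"
    show "(A X *\<^sub>v v X) $ r = (\<Sum>c<n. A X $$ (r, c) * v X $ c)"
      using assms(1)[OF X] assms(2)[OF X] assms(5)
      by (auto simp: scalar_prod_def lessThan_atLeast0 intro!: sum.cong)
  qed
qed

lemma network_state_carrier:
  assumes "\<And>j. j \<le> t \<Longrightarrow> U j \<in> carrier_mat (2 ^ m) (2 ^ m)"
  shows "network_state m U X t \<in> carrier_vec (2 ^ m)"
  using assms[of t] by (cases t) (auto intro!: carrier_vecI)

lemma multilinear_fun_amplitude:
  assumes "\<And>j. j \<le> t \<Longrightarrow> U j \<in> carrier_mat (2 ^ m) (2 ^ m)" and "k < 2 ^ m"
  shows "multilinear_fun N t (\<lambda>X. network_state m U X t $ k)"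
  using assms
proof (induction t arbitrary: k)
  case 0
  show ?case
    by (simp add: multilinear_fun_const)
next
  case (Suc t)
  have Q: "query_mat m X \<in> carrier_mat (2 ^ m) (2 ^ m)" for X
    by (simp add: query_mat_def)
  have v: "network_state m U X t \<in> carrier_vec (2 ^ m)" for X
    using Suc.prems by (intro network_state_carrier) auto
  have "multilinear_fun N (1 + t) (\<lambda>X. (query_mat m X *\<^sub>v network_state m U X t) $ r)"
    if "r < 2 ^ m" for r
  proof (rule multilinear_fun_mult_mat_vec[where n = "2 ^ m"])
    show "multilinear_fun N 1 (\<lambda>X. query_mat m X $$ (r, c))" if "r < 2 ^ m" "c < 2 ^ m" for r c
      by (rule multilinear_fun.cong[OF multilinear_fun_query_mat_entry[of N r m c]])
         (use that in \<open>simp add: query_mat_def of_bool_def\<close>)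
  qed (use that Q v Suc in auto)
  \<comment> \<open>The entries of \<open>U (Suc t)\<close> do not depend on the input, so only the
    query raises the degree.\<close>
  then have "multilinear_fun N (0 + (1 + t))
      (\<lambda>X. (U (Suc t) *\<^sub>v (query_mat m X *\<^sub>v network_state m U X t)) $ k)"
    using Suc.prems mult_mat_vec_carrier[OF Q v] multilinear_fun_const
    by (intro multilinear_fun_mult_mat_vec[where n = "2 ^ m" and d = 0 and e = "1 + t"]) simp_all
  then show ?case
    by simp
qed

text \<open>The probability is embedded into the complex numbers because its factors, an amplitude
  and its conjugate, are complex.\<close>

lemma multilinear_fun_observation_prob:
  assumes "\<And>j. j \<le> T \<Longrightarrow> U j \<in> carrier_mat (2 ^ m) (2 ^ m)" and "B \<subseteq> {..<2 ^ m}"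
  shows "multilinear_fun N (2 * T)
    (\<lambda>X. complex_of_real (observation_prob (network_state m U X T) B))"
proof -
  have "multilinear_fun N (T + T) (\<lambda>X. \<Sum>k\<in>B.
      network_state m U X T $ k * cnj (network_state m U X T $ k))"
    using assms
    by (intro multilinear_fun_sum multilinear_fun_mult multilinear_fun_cnj
        multilinear_fun_amplitude) auto
  then show ?thesis
    by (simp add: observation_prob_def complex_mult_cnj cmod_power2 mult_2)
qed

text \<open>The exponents of the squarefree monomial with variables \<open>S\<close>, for finite
  \<open>S\<close>.\<close>

definition indicator_exponents :: "nat set \<Rightarrow> (nat \<Rightarrow>\<^sub>0 nat)" where
  "indicator_exponents S = Poly_Mapping.Abs_poly_mapping (\<lambda>i. of_bool (i \<in> S))"

lemma lookup_indicator_exponents: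
  "finite S \<Longrightarrow> Poly_Mapping.lookup (indicator_exponents S) i = of_bool (i \<in> S)"
  by (simp add: indicator_exponents_def Abs_poly_mapping_inverse)

lemma keys_indicator_exponents:
  "finite S \<Longrightarrow> Poly_Mapping.keys (indicator_exponents S) = S"
  by (auto simp: in_keys_iff lookup_indicator_exponents)

lemma ex_multilinear_mpoly:
  fixes c :: "nat set \<Rightarrow> real"
  shows "\<exists>P :: real_mpoly. mpoly_vars P \<subseteq> {..<N} \<and> multilinear P \<and> mpoly_degree P \<le> d \<and>
    (\<forall>x. mpoly_eval P x = (\<Sum>S | S \<subseteq> {..<N} \<and> card S \<le> d. c S * (\<Prod>i\<in>S. x i)))"
proof -
  define F where "F = {S. S \<subseteq> {..<N} \<and> card S \<le> d}"
  have finF: "finite F"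
    unfolding F_def by (rule finite_subset[of _ "Pow {..<N}"]) auto
  have fin: "finite S" if "S \<in> F" for S
    using that finite_subset by (auto simp: F_def)
  \<comment> \<open>On finite sets \<open>Poly_Mapping.keys\<close> inverts
    \<open>indicator_exponents\<close>, so it recovers the set that indexes the coefficient.\<close>
  define P :: real_mpoly where
    "P = Poly_Mapping.Abs_poly_mapping
      (\<lambda>\<mu>. if \<mu> \<in> indicator_exponents ` F then c (Poly_Mapping.keys \<mu>) else 0)"
  have "finite {\<mu>. (if \<mu> \<in> indicator_exponents ` F then c (Poly_Mapping.keys \<mu>) else 0) \<noteq> 0}"
    by (rule finite_subset[of _ "indicator_exponents ` F"]) (use finF in auto)
  then have lookup: "Poly_Mapping.lookup P \<mu> =
      (if \<mu> \<in> indicator_exponents ` F then c (Poly_Mapping.keys \<mu>) else 0)" for \<mu>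
    unfolding P_def by (subst Abs_poly_mapping_inverse) auto
  \<comment> \<open>Only an inclusion, since some \<open>c S\<close> may vanish. The evaluation
    below extends its sum to the whole image by zero terms.\<close>
  have keys: "Poly_Mapping.keys P \<subseteq> indicator_exponents ` F"
    by (auto simp: in_keys_iff lookup split: if_splits)
  have inj: "inj_on indicator_exponents F"
    by (rule inj_on_inverseI[of _ Poly_Mapping.keys]) (simp add: keys_indicator_exponents fin)
  have monomials: "Poly_Mapping.keys \<mu> \<subseteq> {..<N} \<and>
      (\<forall>i. Poly_Mapping.lookup \<mu> i \<le> 1) \<and> monomial_degree \<mu> \<le> d"
    if "\<mu> \<in> Poly_Mapping.keys P" for \<mu>
  proof -
    from that keys obtain S where S: "S \<in> F" "\<mu> = indicator_exponents S"
      by blast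
    with fin[OF S(1)] show ?thesis
      by (simp add: monomial_degree_def keys_indicator_exponents lookup_indicator_exponents)
         (simp add: F_def)
  qed
  then have "mpoly_vars P \<subseteq> {..<N}"
    unfolding mpoly_vars_def by blast
  moreover have "multilinear P"
    using monomials unfolding multilinear_def by blast
  moreover have "mpoly_degree P \<le> d"
    using monomials by (simp add: mpoly_degree_def)
  moreover have "mpoly_eval P x = (\<Sum>S\<in>F. c S * (\<Prod>i\<in>S. x i))" for x
  proof -
    have "mpoly_eval P x = (\<Sum>\<mu>\<in>indicator_exponents ` F.
        Poly_Mapping.lookup P \<mu> * (\<Prod>i\<in>Poly_Mapping.keys \<mu>. x i ^ Poly_Mapping.lookup \<mu> i))"
      unfolding mpoly_eval_def
      using finF keys by (intro sum.mono_neutral_left) (auto simp: in_keys_iff)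
    also have "\<dots> = (\<Sum>S\<in>F. c S * (\<Prod>i\<in>S. x i))"
      by (subst sum.reindex[OF inj])
         (auto simp: lookup keys_indicator_exponents lookup_indicator_exponents fin
           intro!: sum.cong)
    finally show ?thesis .
  qed
  ultimately show ?thesis
    unfolding F_def by blast
qed

theorem lemma4p2:
  fixes N m T :: nat and U :: "nat \<Rightarrow> complex mat" and B :: "nat set"
  assumes "quantum_network N m T U"
    and "B \<subseteq> {..<2 ^ m}"
  shows "\<exists>P :: real_mpoly. mpoly_vars P \<subseteq> {..<N} \<and> multilinear P \<and> mpoly_degree P \<le> 2 * T \<and>
    (\<forall>X :: bool list. length X = N \<longrightarrow>
       mpoly_eval P (\<lambda>i. of_bool (X ! i)) = observation_prob (network_state m U X T) B)"
proof -
  have U: "U j \<in> carrier_mat (2 ^ m) (2 ^ m)" if "j \<le> T" for j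
    using assms(1) that by (auto simp: quantum_network_def unitary_mat_def)
  obtain c where c: "\<And>X. length X = N \<Longrightarrow>
      complex_of_real (observation_prob (network_state m U X T) B) =
      (\<Sum>S | S \<subseteq> {..<N} \<and> card S \<le> 2 * T. c S * of_bool (\<forall>i\<in>S. X ! i))"
    using multilinear_fun_coefficients[OF multilinear_fun_observation_prob[of T U, OF U assms(2)]]
    by blast
  \<comment> \<open>The probability and the monomials are real at every input, so replacing each
    coefficient by its real part does not change the value.\<close>
  obtain P :: real_mpoly where P:
    "mpoly_vars P \<subseteq> {..<N}" "multilinear P" "mpoly_degree P \<le> 2 * T"
    "\<And>x. mpoly_eval P x =
      (\<Sum>S | S \<subseteq> {..<N} \<and> card S \<le> 2 * T. Re (c S) * (\<Prod>i\<in>S. x i))"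
    using ex_multilinear_mpoly[of N "2 * T" "\<lambda>S. Re (c S)"] by blast
  have "mpoly_eval P (\<lambda>i. of_bool (X ! i)) = observation_prob (network_state m U X T) B"
    if X: "length X = N" for X
  proof -
    \<comment> \<open>At bits, a squarefree monomial is the conjunction of its variables.\<close>
    have "(\<Prod>i\<in>S. of_bool (X ! i)) = (of_bool (\<forall>i\<in>S. X ! i) :: real)" if "S \<subseteq> {..<N}" for S
      using finite_subset[OF that] by (induction S rule: finite_induct) auto
    then have "mpoly_eval P (\<lambda>i. of_bool (X ! i)) =
        (\<Sum>S | S \<subseteq> {..<N} \<and> card S \<le> 2 * T. Re (c S) * of_bool (\<forall>i\<in>S. X ! i))"
      unfolding P(4) by (intro sum.cong) auto
    also have "\<dots> = Re (\<Sum>S | S \<subseteq> {..<N} \<and> card S \<le> 2 * T. c S * of_bool (\<forall>i\<in>S. X ! i))"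
      unfolding Re_sum by (intro sum.cong) auto
    also have "\<dots> = observation_prob (network_state m U X T) B"
      by (simp flip: c[OF X])
    finally show ?thesis .
  qed
  with P(1-3) show ?thesis
    by blast
qed

end
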